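(* For $n\ge1$ let $T_n$ be the number of ordered bilabelled increasing trees with $n$ nodes (i.e. pairs consisting of an ordered tree with $n$ nodes and an increasing bilabelling of it with label set $\{1,\dots,2n\}$), and let $T(z)=\sum_{n\ge1}T_n\frac{z^{2n}}{(2n)!}$. Then \[T(z)=1-\exp\!\Big(-\big(\mathrm{erf}^{-1}(\tfrac{\sqrt2}{\sqrt\pi}z)\big)^2\Big)=\sqrt{\pi}\int_0^{\frac{z\sqrt2}{\sqrt\pi}}\mathrm{erf}^{-1}(x)\,dx.\] Moreover $T_n=\frac{(2n-2)!}{2^{n-1}}\,c_{n-1}$ for $n\ge1$, and the $T_n$ satisfy \[T_n=\sum_{k=1}^{n-1}\binom{2n-2}{2k}T_kT_{n-k}\quad (n\ge2),\qquad T_1=1.\]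
   Context: Ordered trees are rooted trees in which the children of each node form a linearly ordered sequence. An increasing bilabelling of a tree with $n$ nodes assigns to each node a set of exactly two integers from $\{1,\dots,2n\}$, these sets partitioning $\{1,\dots,2n\}$, such that every label of a child is larger than both labels of its parent. $\mathrm{erf}(z)=\frac{2}{\sqrt\pi}\int_0^z e^{-x^2}dx$ is the error function and $\mathrm{erf}^{-1}$ its inverse, whose expansion is $\mathrm{erf}^{-1}(z)=\sum_{k\ge0}\frac{c_k}{2k+1}\big(\frac{\sqrt\pi}{2}z\big)^{2k+1}$ with $c_0=1$ and $c_k=\sum_{m=0}^{k-1}\frac{c_mc_{k-1-m}}{(m+1)(2m+1)}$ for $k>0$. *)

theory Defs
  imports
    "HOL-Analysis.Analysis"
    "HOL-Library.Disjoint_Sets"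
    "HOL-Computational_Algebra.Formal_Power_Series"
begin

text \<open>
  An ordered tree together with an assignment of a decoration of type \<open>'a\<close> to each of its nodes;
  for bilabellings the decorations are sets of natural numbers.
\<close>

datatype 'a otree = Node (root_label: 'a) (subtrees: "'a otree list")

fun node_labels :: "'a otree \<Rightarrow> 'a list" where
  "node_labels (Node a ts) = a # concat (map node_labels ts)"

definition num_nodes :: "'a otree \<Rightarrow> nat" where
  "num_nodes t = length (node_labels t)"

fun increasing :: "nat set otree \<Rightarrow> bool" where
  "increasing (Node A ts) \<longleftrightarrow>
     (\<forall>t\<in>set ts. (\<forall>a\<in>A. \<forall>b\<in>root_label t. a < b) \<and> increasing t)"

text \<open>
  \<open>distinct\<close> is needed besides \<open>partition_on\<close>, since the latter only sees the set of
  the label sets: no two nodes may carry the same label set.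
\<close>

definition bilabelling :: "nat set otree \<Rightarrow> bool" where
  "bilabelling t \<longleftrightarrow>
     (\<forall>A\<in>set (node_labels t). card A = 2) \<and>
     distinct (node_labels t) \<and>
     partition_on {1..2 * num_nodes t} (set (node_labels t))"

definition bilabelled_increasing_trees :: "nat \<Rightarrow> nat set otree set" where
  "bilabelled_increasing_trees n = {t. num_nodes t = n \<and> bilabelling t \<and> increasing t}"

definition num_trees :: "nat \<Rightarrow> nat" where
  "num_trees n = card (bilabelled_increasing_trees n)"

definition tree_gf :: "real fps" where
  "tree_gf = Abs_fps (\<lambda>m. if even m \<and> m \<ge> 2 then of_nat (num_trees (m div 2)) / fact m else 0)"

text \<open>The interval integral is oriented, so this is also correct for negative arguments.\<close>

definition erf :: "real \<Rightarrow> real" where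
  "erf z = 2 / sqrt pi * (LBINT x=0..ereal z. exp (- (x\<^sup>2)))"

text \<open>Only meaningful on the range \<open>{-1<..<1}\<close> of \<^const>\<open>erf\<close>.\<close>

definition erf_inv :: "real \<Rightarrow> real" where
  "erf_inv = inv erf"

text \<open>
  The Taylor series at \<open>0\<close> of the error function and of its inverse;
  \<^const>\<open>fps_inv\<close> is the compositional inverse.
\<close>

definition erf_fps :: "real fps" where
  "erf_fps = fps_const (2 / sqrt pi) * fps_integral0 (fps_exp (- 1) oo fps_X\<^sup>2)"

definition erf_inv_fps :: "real fps" where
  "erf_inv_fps = fps_inv erf_fps"

fun erf_inv_coeff :: "nat \<Rightarrow> real" where
  "erf_inv_coeff k =
     (if k = 0 then 1
      else \<Sum>m<k. erf_inv_coeff m * erf_inv_coeff (k - 1 - m) / ((real m + 1) * (2 * real m + 1)))"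

declare erf_inv_coeff.simps [simp del]

end

theory Submission
  imports Defs "HOL-Probability.Distributions"
begin

text \<open>
  The root of a bilabelled increasing tree carries the two smallest labels. Detaching its first
  subtree splits a tree on a label set into two smaller ones, whence the recurrence for the numbers
  \<open>T\<^sub>n\<close> and, for the generating function, \<open>T'' = 1 + T T''\<close> with \<open>T(0) = T'(0) = 0\<close>. With
  \<open>g(z) = erf\<^sup>-\<^sup>1 (z sqrt 2 / sqrt \<pi>)\<close> one has \<open>sqrt 2 g' = exp (g\<^sup>2)\<close>, so \<open>1 - exp (- g\<^sup>2)\<close> has
  derivative \<open>sqrt 2 g\<close> and solves the same initial value problem, which determines the formal power
  series. The recurrence for \<open>c\<^sub>k\<close> is that for \<open>T\<^sub>n\<close> up to scaling.

  For convergence on all of \<open>|z| < sqrt (\<pi> / 2)\<close>, the differential equation shows by induction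
  that on the nonnegative half the partial sums of the series, whose coefficients are nonnegative,
  are bounded by \<open>1 - exp (- g\<^sup>2)\<close>.
\<close>

unbundle no vec_syntax
unbundle fps_syntax

section \<open>Trees on an arbitrary label set\<close>

text \<open>Phrased for lists of label sets rather than for trees, so that it splits along
  concatenation. The set of all labels is left free, because a subtree of a bilabelled tree has an
  arbitrary label set.\<close>

definition pairs_disjoint :: "nat set list \<Rightarrow> bool" where
  "pairs_disjoint xs \<longleftrightarrow> (\<forall>A\<in>set xs. card A = 2) \<and> distinct xs \<and> disjoint (set xs)"

definition trees_on :: "nat set \<Rightarrow> nat set otree set" where
  "trees_on S = {t. pairs_disjoint (node_labels t) \<and> \<Union>(set (node_labels t)) = S \<and> increasing t}"

text \<open>Forwards, distinctness of the concatenation makes an entry of \<open>xs\<close> and an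
  entry of \<open>ys\<close> different members of one disjoint family. Backwards, a common entry
  would be disjoint from itself, hence empty, against cardinality 2.\<close>

lemma pairs_disjoint_append:
  "pairs_disjoint (xs @ ys) \<longleftrightarrow>
     pairs_disjoint xs \<and> pairs_disjoint ys \<and> \<Union>(set xs) \<inter> \<Union>(set ys) = {}"
proof
  assume L: "pairs_disjoint (xs @ ys)"
  have "A \<inter> B = {}" if "A \<in> set xs" "B \<in> set ys" for A B
  proof -
    have "A \<noteq> B" "disjoint (set xs \<union> set ys)" using L that unfolding pairs_disjoint_def by auto
    then show ?thesis using that by (auto dest: disjointD)
  qed
  then show "pairs_disjoint xs \<and> pairs_disjoint ys \<and> \<Union>(set xs) \<inter> \<Union>(set ys) = {}"
    using L unfolding pairs_disjoint_def pairwise_def by auto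
next
  assume R: "pairs_disjoint xs \<and> pairs_disjoint ys \<and> \<Union>(set xs) \<inter> \<Union>(set ys) = {}"
  have disj: "A \<inter> B = {}" if "A \<in> set xs" "B \<in> set ys" for A B
    using R that by auto
  have "set xs \<inter> set ys = {}"
  proof (rule ccontr)
    assume "set xs \<inter> set ys \<noteq> {}"
    then obtain A where "A \<in> set xs" "A \<in> set ys" by auto
    with disj[of A A] R show False unfolding pairs_disjoint_def by auto
  qed
  moreover have "disjoint (set xs \<union> set ys)"
  proof (rule pairwiseI)
    fix A B assume "A \<in> set xs \<union> set ys" "B \<in> set xs \<union> set ys" "A \<noteq> B"
    then show "disjnt A B"
      using disj[of A B] disj[of B A] R unfolding pairs_disjoint_def
      by (auto simp: disjnt_def Int_commute dest: disjointD)
  qed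
  ultimately show "pairs_disjoint (xs @ ys)"
    using R unfolding pairs_disjoint_def by auto
qed

lemma node_labels_nonempty: "node_labels t \<noteq> []"
  by (cases t) auto

lemma root_label_in: "root_label t \<in> set (node_labels t)"
  by (cases t) auto

lemma card_Union_pairs_disjoint:
  assumes "pairs_disjoint xs"
  shows "card (\<Union>(set xs)) = 2 * length xs"
proof -
  have "card (\<Union>(set xs)) = sum card (set xs)"
    using assms unfolding pairs_disjoint_def
    by (intro card_Union_disjoint) (auto intro: card_ge_0_finite)
  also have "\<dots> = 2 * length xs"
    using assms unfolding pairs_disjoint_def by (simp add: distinct_card)
  finally show ?thesis .
qed

lemma card_trees_on:
  assumes "t \<in> trees_on S"
  shows "card S = 2 * num_nodes t"
  using assms card_Union_pairs_disjoint[of "node_labels t"]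
  by (simp add: trees_on_def num_nodes_def)

text \<open>Each node uses up two labels, so the label set already forces the number of nodes;
  blocks of size 2 are nonempty, as \<open>partition_on\<close> requires.\<close>

lemma bilabelled_increasing_trees_eq: "bilabelled_increasing_trees n = trees_on {1..2 * n}"
proof (intro set_eqI iffI)
  fix t assume "t \<in> bilabelled_increasing_trees n"
  then show "t \<in> trees_on {1..2 * n}"
    unfolding bilabelled_increasing_trees_def bilabelling_def trees_on_def pairs_disjoint_def
      partition_on_def by auto
next
  fix t assume t: "t \<in> trees_on {1..2 * n}"
  then have n: "num_nodes t = n" using card_trees_on[OF t] by simp
  have "{} \<notin> set (node_labels t)"
  proof
    assume "{} \<in> set (node_labels t)"
    then have "card ({} :: nat set) = 2" using t unfolding trees_on_def pairs_disjoint_def by blast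
    then show False by simp
  qed
  then show "t \<in> bilabelled_increasing_trees n" using t n
    unfolding bilabelled_increasing_trees_def bilabelling_def trees_on_def pairs_disjoint_def
      partition_on_def by auto
qed

text \<open>\<open>increasing\<close> compares only parent and child. A deeper node is reached
  through some label \<open>r\<close> of the intermediate root, which exists because label sets are
  nonempty.\<close>

lemma increasing_root_less:
  assumes "increasing t" "\<forall>A\<in>set (node_labels t). A \<noteq> {}" "B \<in> set (node_labels t)"
    "B \<noteq> root_label t" "a \<in> root_label t" "b \<in> B"
  shows "a < b"
  using assms
proof (induction t arbitrary: a)
  case (Node A ts)
  from Node.prems obtain s where s: "s \<in> set ts" "B \<in> set (node_labels s)" by auto
  have inc: "increasing s" and less: "\<And>r. r \<in> root_label s \<Longrightarrow> a < r"
    using Node.prems s(1) by auto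
  have ne: "\<forall>A\<in>set (node_labels s). A \<noteq> {}" using Node.prems(2) s(1) by auto
  show ?case
  proof (cases "B = root_label s")
    case True
    then show ?thesis using less Node.prems(6) by auto
  next
    case False
    obtain r where r: "r \<in> root_label s" using ne root_label_in[of s] by auto
    from Node.IH[OF s(1) inc ne s(2) False r Node.prems(6)] less[OF r] show ?thesis by simp
  qed
qed

section \<open>The two smallest labels and detaching the first subtree\<close>

definition initial_pair :: "nat set \<Rightarrow> nat set \<Rightarrow> bool" where
  "initial_pair A S \<longleftrightarrow> A \<subseteq> S \<and> card A = 2 \<and> (\<forall>a\<in>A. \<forall>b\<in>S - A. a < b)"

text \<open>Two different sets of the same finite size each have an element outside the other, and
  these two elements would each be smaller than the other.\<close>

lemma initial_pair_unique:
  assumes "initial_pair A S" "initial_pair B S"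
  shows "A = B"
proof (rule ccontr)
  assume "A \<noteq> B"
  have fin: "finite A" "finite B" and card: "card A = card B"
    using assms unfolding initial_pair_def by (auto intro: card_ge_0_finite)
  have "\<not> A \<subseteq> B" "\<not> B \<subseteq> A"
    using \<open>A \<noteq> B\<close> card fin card_subset_eq by metis+
  then obtain a b where "a \<in> A - B" "b \<in> B - A" by auto
  then have "a < b" "b < a" using assms unfolding initial_pair_def by auto
  then show False by simp
qed

lemma initial_pair_exists:
  assumes "finite S" "card S \<ge> 2"
  obtains A where "initial_pair A S"
proof -
  define a where "a = Min S"
  define b where "b = Min (S - {a})"
  have "S \<noteq> {}" using assms by auto
  then have a: "a \<in> S" "\<And>x. x \<in> S \<Longrightarrow> a \<le> x" unfolding a_def using assms by auto
  have "card (S - {a}) \<ge> 1" using assms a by simp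
  then have "S - {a} \<noteq> {}" by (metis card.empty not_one_le_zero)
  then have b: "b \<in> S - {a}" "\<And>x. x \<in> S - {a} \<Longrightarrow> b \<le> x"
    unfolding b_def using assms by (auto intro: Min_in Min_le simp del: Diff_iff)
  have "x < y" if "x \<in> {a, b}" "y \<in> S - {a, b}" for x y
    using that a b(1) b(2)[of y] by (auto simp: order_less_le)
  then have "initial_pair {a, b} S"
    unfolding initial_pair_def using a b by auto
  then show ?thesis by (rule that)
qed

lemma root_label_trees_on:
  assumes "t \<in> trees_on S"
  shows "initial_pair (root_label t) S"
proof -
  have ne: "\<forall>A\<in>set (node_labels t). A \<noteq> {}"
    using assms unfolding trees_on_def pairs_disjoint_def by auto
  have "a < b" if ab: "a \<in> root_label t" "b \<in> S - root_label t" for a b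
  proof -
    obtain B where "B \<in> set (node_labels t)" "b \<in> B"
      using ab assms unfolding trees_on_def by blast
    then show ?thesis
      using increasing_root_less[OF _ ne, of B a b] that assms unfolding trees_on_def by auto
  qed
  then show ?thesis
    using assms root_label_in[of t] unfolding initial_pair_def trees_on_def pairs_disjoint_def
    by auto
qed

text \<open>The set \<open>U\<close> consists of the labels of the first subtree. The label list of
  the whole tree is a rearrangement of those of \<open>t\<close> and of \<open>Node A ts\<close>,
  and \<open>pairs_disjoint\<close> is insensitive to order.\<close>

lemma trees_on_Node_Cons:
  "Node A (t # ts) \<in> trees_on S \<longleftrightarrow>
     (\<exists>U\<subseteq>S. t \<in> trees_on U \<and> Node A ts \<in> trees_on (S - U) \<and>
        (\<forall>a\<in>A. \<forall>b\<in>root_label t. a < b))"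
proof -
  have pd: "pairs_disjoint (node_labels (Node A (t # ts))) \<longleftrightarrow>
      pairs_disjoint (node_labels t @ node_labels (Node A ts))"
    unfolding pairs_disjoint_def by auto
  have un: "\<Union>(set (node_labels (Node A (t # ts)))) =
      \<Union>(set (node_labels t)) \<union> \<Union>(set (node_labels (Node A ts)))" by auto
  have inc: "increasing (Node A (t # ts)) \<longleftrightarrow>
      increasing t \<and> increasing (Node A ts) \<and> (\<forall>a\<in>A. \<forall>b\<in>root_label t. a < b)" by auto
  have "(X \<inter> Y = {} \<and> X \<union> Y = S) \<longleftrightarrow> X \<subseteq> S \<and> Y = S - X" for X Y by blast
  then show ?thesis
    unfolding trees_on_def mem_Collect_eq pd pairs_disjoint_append un inc by metis
qed

lemma trees_on_pair:
  assumes "card A = 2"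
  shows "trees_on A = {Node A []}"
proof (intro equalityI subsetI)
  fix t assume t: "t \<in> trees_on A"
  obtain B ts where B: "t = Node B ts" by (cases t)
  have "num_nodes t = 1" using card_trees_on[OF t] assms by simp
  then have "ts = []" unfolding B num_nodes_def
    by (cases ts) (auto simp: node_labels_nonempty)
  then show "t \<in> {Node A []}" using t B unfolding trees_on_def by auto
qed (auto simp: trees_on_def pairs_disjoint_def assms)

text \<open>Here \<open>t\<close> is the first subtree and \<open>s\<close> is what remains after
  its removal. As \<open>U\<close> avoids \<open>A\<close>, the pair \<open>A\<close> stays initial
  in \<open>S - U\<close> and is therefore the root label of \<open>s\<close>. The conditions on
  \<open>U\<close> hold for every label set of a tree and prepare the summation over sizes
  \<open>2 * k\<close>.\<close>

lemma bij_betw_detach_first_subtree: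
  assumes A: "initial_pair A S" and S: "card S > 2"
  shows "bij_betw (\<lambda>(U, t, s). Node A (t # subtrees s))
     (SIGMA U:{U. U \<subseteq> S - A \<and> U \<noteq> {} \<and> even (card U)}. trees_on U \<times> trees_on (S - U))
     (trees_on S)" (is "bij_betw ?f ?D _")
proof -
  have root: "root_label s = A" if "s \<in> trees_on (S - U)" "U \<subseteq> S - A" for s U
  proof -
    have "initial_pair A (S - U)" using A that unfolding initial_pair_def by auto
    then show ?thesis using root_label_trees_on[OF that(1)] initial_pair_unique by blast
  qed
  show ?thesis
  proof (intro bij_betw_imageI inj_onI equalityI subsetI)
    fix p q assume pq: "p \<in> ?D" "q \<in> ?D" "?f p = ?f q"
    obtain U t s where p: "p = (U, t, s)" by (cases p)
    obtain V t' s' where q: "q = (V, t', s')" by (cases q)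
    from pq p q have "t = t'" "subtrees s = subtrees s'" "root_label s = A" "root_label s' = A"
      using root by auto
    moreover from this have "s = s'" by (intro otree.expand) auto
    \<comment> \<open>The label set is recovered from the tree as the union of its node
      labels.\<close>
    moreover have "U = V" using pq p q \<open>t = t'\<close> unfolding trees_on_def by auto
    ultimately show "p = q" using p q by simp
  next
    fix x assume "x \<in> ?f ` ?D"
    then obtain U t s where x: "x = Node A (t # subtrees s)" "U \<subseteq> S - A"
      "t \<in> trees_on U" "s \<in> trees_on (S - U)" by auto
    have "Node A (subtrees s) = s" using root[OF x(4,2)] by (intro otree.expand) auto
    moreover have "root_label t \<subseteq> U"
      using root_label_trees_on[OF x(3)] unfolding initial_pair_def by auto
    ultimately show "x \<in> trees_on S" unfolding x(1) trees_on_Node_Cons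
      using x A unfolding initial_pair_def by (intro exI[of _ U]) auto
  next
    fix x assume xS: "x \<in> trees_on S"
    then have "root_label x = A" using A root_label_trees_on initial_pair_unique by blast
    then obtain us where x: "x = Node A us" by (cases x) auto
    \<comment> \<open>A single node would only use the two labels in \<open>A\<close>, but
      \<open>S\<close> has more than two.\<close>
    have "us \<noteq> []"
      using xS S A unfolding x trees_on_def initial_pair_def by auto
    then obtain t ts where us: "us = t # ts" by (cases us) auto
    from xS[unfolded x us trees_on_Node_Cons] obtain U where U: "U \<subseteq> S" "t \<in> trees_on U"
      "Node A ts \<in> trees_on (S - U)" by auto
    have "A \<subseteq> S - U" using root_label_trees_on[OF U(3)] unfolding initial_pair_def by auto
    then have "U \<subseteq> S - A" using U(1) by auto
    moreover have "U \<noteq> {}" "even (card U)"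
      using card_trees_on[OF U(2)] node_labels_nonempty[of t] by (auto simp: num_nodes_def)
    ultimately have D: "(U, t, Node A ts) \<in> ?D" using U by auto
    show "x \<in> ?f ` ?D" by (rule image_eqI[OF _ D]) (simp add: x us)
  qed
qed

section \<open>The recurrence for the number of trees\<close>

lemma sum_even_subsets_card:
  fixes h :: "nat \<Rightarrow> nat"
  assumes "finite X"
  shows "(\<Sum>U | U \<subseteq> X \<and> U \<noteq> {} \<and> even (card U). h (card U div 2)) =
     (\<Sum>k=1..card X div 2. (card X choose (2 * k)) * h k)"
proof -
  let ?I = "{U. U \<subseteq> X \<and> U \<noteq> {} \<and> even (card U)}"
  have fin: "finite ?I" using assms by simp
  have "card U div 2 \<in> {1..card X div 2}" if U: "U \<in> ?I" for U
  proof -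
    have "card U \<noteq> 0" using U assms finite_subset by fastforce
    then have "card U \<ge> 2" using U by (auto elim!: evenE)
    moreover have "card U \<le> card X" using U assms by (auto intro: card_mono)
    ultimately show ?thesis using div_le_mono by fastforce
  qed
  then have "sum (\<lambda>U. h (card U div 2)) ?I =
      (\<Sum>k=1..card X div 2. \<Sum>U | U \<in> ?I \<and> card U div 2 = k. h (card U div 2))"
    by (intro sum.group[symmetric] fin image_subsetI) auto
  also have "\<dots> = (\<Sum>k=1..card X div 2. (card X choose (2 * k)) * h k)"
  proof (rule sum.cong[OF refl])
    fix k assume k: "k \<in> {1..card X div 2}"
    have "{U. U \<in> ?I \<and> card U div 2 = k} = {U. U \<subseteq> X \<and> card U = 2 * k}"
      using k by (auto elim!: evenE)
    then have "card {U. U \<in> ?I \<and> card U div 2 = k} = card X choose (2 * k)"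
      using n_subsets[OF assms] by simp
    then show "(\<Sum>U | U \<in> ?I \<and> card U div 2 = k. h (card U div 2)) =
        (card X choose (2 * k)) * h k" by simp
  qed
  finally show ?thesis .
qed

lemma num_trees_1: "num_trees 1 = 1"
  unfolding num_trees_def bilabelled_increasing_trees_eq by (subst trees_on_pair) auto

text \<open>Sum the product of the two counts over the possible label sets of the first subtree. The
  counts for smaller label sets enter as the hypothesis \<open>sub\<close>, so that the lemma can
  serve inside the induction that establishes them.\<close>

lemma trees_on_recurrence:
  assumes S: "finite S" "card S = 2 * n" and n: "n \<ge> 2"
    and sub: "\<And>k U. 1 \<le> k \<Longrightarrow> k < n \<Longrightarrow> finite U \<Longrightarrow> card U = 2 * k \<Longrightarrow>
        finite (trees_on U) \<and> card (trees_on U) = num_trees k"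
  shows "finite (trees_on S) \<and> card (trees_on S) =
     (\<Sum>k=1..n - 1. ((2 * n - 2) choose (2 * k)) * num_trees k * num_trees (n - k))"
proof -
  have "card S \<ge> 2" "card S > 2" using S n by auto
  then obtain A where A: "initial_pair A S" using initial_pair_exists S by blast
  let ?I = "{U. U \<subseteq> S - A \<and> U \<noteq> {} \<and> even (card U)}"
  let ?D = "SIGMA U:?I. trees_on U \<times> trees_on (S - U)"
  have cX: "card (S - A) = 2 * n - 2"
    using A S unfolding initial_pair_def by (simp add: card_Diff_subset card_ge_0_finite)
  have finX: "finite (S - A)" using S by simp
  have U: "finite (trees_on U) \<and> card (trees_on U) = num_trees (card U div 2) \<and>
      finite (trees_on (S - U)) \<and> card (trees_on (S - U)) = num_trees (n - card U div 2)"
    if "U \<in> ?I" for U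
  proof -
    from that obtain k where k: "card U = 2 * k" by (auto elim!: evenE)
    have finU: "finite U" using that finX finite_subset by blast
    then have k1: "k \<ge> 1" using that k by (cases k) auto
    have "card U \<le> 2 * n - 2" using that card_mono[OF finX] cX by auto
    then have kn: "k < n" using k n by simp
    have "card (S - U) = 2 * (n - k)" using that finU k S by (subst card_Diff_subset) auto
    then show ?thesis
      using sub[OF k1 kn finU k] sub[of "n - k" "S - U"] k k1 kn S by simp
  qed
  have bij: "bij_betw (\<lambda>(U, t, s). Node A (t # subtrees s)) ?D (trees_on S)"
    by (rule bij_betw_detach_first_subtree[OF A \<open>card S > 2\<close>])
  have "finite ?I" using finX by simp
  then have "finite ?D" using U by (intro finite_SigmaI) auto
  then have fin: "finite (trees_on S)" using bij bij_betw_finite by blast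
  have "card (trees_on S) = card ?D" using bij bij_betw_same_card by fastforce
  also have "\<dots> = (\<Sum>U\<in>?I. num_trees (card U div 2) * num_trees (n - card U div 2))"
    using \<open>finite ?I\<close> U by (subst card_SigmaI) (auto simp: card_cartesian_product)
  also have "\<dots> = (\<Sum>k=1..n - 1. ((2 * n - 2) choose (2 * k)) * num_trees k * num_trees (n - k))"
  proof -
    have "(2 * n - 2) div 2 = n - 1" by simp
    then show ?thesis
      using sum_even_subsets_card[OF finX, of "\<lambda>k. num_trees k * num_trees (n - k)"]
      by (simp add: cX mult.assoc)
  qed
  finally show ?thesis using fin by simp
qed

text \<open>
  The recurrence shows that the number of trees on a label set depends only on its cardinality,
  so no relabelling along order isomorphisms is needed.
\<close>

lemma card_trees_on_eq_num_trees:
  assumes "finite S" "card S = 2 * n" "n \<ge> 1"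
  shows "finite (trees_on S) \<and> card (trees_on S) = num_trees n"
  using assms
proof (induction n arbitrary: S rule: less_induct)
  case (less n)
  show ?case
  proof (cases "n = 1")
    case True
    then show ?thesis using less.prems trees_on_pair[of S] num_trees_1 by simp
  next
    case False
    then have n: "n \<ge> 2" using less.prems by simp
    have sub: "finite (trees_on U) \<and> card (trees_on U) = num_trees k"
      if "1 \<le> k" "k < n" "finite U" "card U = 2 * k" for k U
      using less.IH that by simp
    have "card (trees_on {1..2 * n}) = num_trees n"
      unfolding num_trees_def bilabelled_increasing_trees_eq ..
    moreover have "finite (trees_on V) \<and> card (trees_on V) =
        (\<Sum>k=1..n - 1. ((2 * n - 2) choose (2 * k)) * num_trees k * num_trees (n - k))"
      if "finite V" "card V = 2 * n" for V
      using that n sub by (rule trees_on_recurrence)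
    ultimately show ?thesis
      using less.prems(1,2) by (metis card_atLeastAtMost diff_Suc_1 finite_atLeastAtMost)
  qed
qed

lemma num_trees_recurrence:
  assumes "n \<ge> 2"
  shows "num_trees n =
     (\<Sum>k=1..n - 1. ((2 * n - 2) choose (2 * k)) * num_trees k * num_trees (n - k))"
proof -
  have "num_trees n = card (trees_on {1..2 * n})"
    unfolding num_trees_def bilabelled_increasing_trees_eq ..
  also have "\<dots> = (\<Sum>k=1..n - 1. ((2 * n - 2) choose (2 * k)) * num_trees k * num_trees (n - k))"
    using trees_on_recurrence[of "{1..2 * n}" n] card_trees_on_eq_num_trees assms by simp
  finally show ?thesis .
qed

section \<open>The formal generating function\<close>

lemma tree_gf_nth_0 [simp]: "tree_gf $ 0 = 0"
  and tree_gf_nth_1 [simp]: "tree_gf $ Suc 0 = 0"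
  by (simp_all add: tree_gf_def)

lemma tree_gf_nth_odd: "odd m \<Longrightarrow> tree_gf $ m = 0"
  by (simp add: tree_gf_def)

lemma tree_gf_nth_even: "n \<ge> 1 \<Longrightarrow> tree_gf $ (2 * n) = real (num_trees n) / fact (2 * n)"
  by (simp add: tree_gf_def)

lemma tree_gf_nth_nonneg: "tree_gf $ m \<ge> 0"
  by (simp add: tree_gf_def)

lemma fact_double_Suc:
  "fact (2 * Suc n) = 2 * ((real n + 1) * (2 * real n + 1)) * fact (2 * n)"
  by (simp add: algebra_simps)

lemma tree_gf_deriv2_nth_even:
  "fps_deriv (fps_deriv tree_gf) $ (2 * n) = real (num_trees (Suc n)) / fact (2 * n)"
proof -
  have "fps_deriv (fps_deriv tree_gf) $ (2 * n) =
      2 * ((real n + 1) * (2 * real n + 1)) * tree_gf $ (2 * Suc n)"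
    by (simp add: algebra_simps)
  also have "\<dots> = real (num_trees (Suc n)) / fact (2 * n)"
  proof -
    have "2 * ((real n + 1) * (2 * real n + 1)) \<noteq> 0" by simp
    then show ?thesis by (simp add: tree_gf_nth_even fact_double_Suc del: fact_Suc mult_Suc_right)
  qed
  finally show ?thesis .
qed

text \<open>Dividing the recurrence by \<open>fact (2 * n)\<close> distributes the binomial
  coefficient over the factors: the right side becomes a Cauchy product of the coefficients of T and
  T''.\<close>

lemma num_trees_div_fact:
  assumes "n \<ge> 1"
  shows "real (num_trees (Suc n)) / fact (2 * n) =
    (\<Sum>k=1..n. real (num_trees k) / fact (2 * k) *
       (real (num_trees (Suc (n - k))) / fact (2 * (n - k))))"
proof -
  have "real (num_trees (Suc n)) =
      (\<Sum>k=1..n. real ((2 * n) choose (2 * k)) * num_trees k * num_trees (Suc n - k))"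
    using num_trees_recurrence[of "Suc n"] assms by simp
  also have "\<dots> = (\<Sum>k=1..n. fact (2 * n) * (real (num_trees k) / fact (2 * k) *
       (real (num_trees (Suc (n - k))) / fact (2 * (n - k)))))"
    by (intro sum.cong refl) (simp add: binomial_fact Suc_diff_le diff_mult_distrib2)
  also have "\<dots> = fact (2 * n) * (\<Sum>k=1..n. real (num_trees k) / fact (2 * k) *
       (real (num_trees (Suc (n - k))) / fact (2 * (n - k))))"
    by (rule sum_distrib_left[symmetric])
  finally show ?thesis by (simp add: field_simps)
qed

text \<open>Coefficientwise: both sides have no odd coefficients, the constant term is the single
  tree with one node, and the other even coefficients agree by
  \<open>num_trees_div_fact\<close>.\<close>

lemma tree_gf_ode: "fps_deriv (fps_deriv tree_gf) = 1 + tree_gf * fps_deriv (fps_deriv tree_gf)"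
proof (rule fps_ext)
  fix m
  let ?D = "fps_deriv (fps_deriv tree_gf)"
  have rhs: "(1 + tree_gf * ?D) $ m = (if m = 0 then 1 else 0) + (\<Sum>i=0..m. tree_gf $ i * ?D $ (m - i))"
    by (simp add: fps_mult_nth)
  show "?D $ m = (1 + tree_gf * ?D) $ m"
  proof (cases "even m")
    case False
    have "tree_gf $ i * ?D $ (m - i) = 0" if "i \<le> m" for i
      using False that by (cases "even i") (auto simp: tree_gf_nth_odd)
    then show ?thesis unfolding rhs using False by (auto simp: tree_gf_nth_odd odd_pos intro!: sum.neutral)
  next
    case True
    then obtain n where m: "m = 2 * n" by (elim evenE)
    show ?thesis
    proof (cases "n = 0")
      case True
      then show ?thesis using tree_gf_deriv2_nth_even[of 0] num_trees_1 m
        by (simp add: fps_mult_nth)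
    next
      case False
      \<comment> \<open>Only positive even \<open>i\<close> contribute, since T is even and has no
        constant term.\<close>
      have "(\<Sum>i=0..m. tree_gf $ i * ?D $ (m - i)) =
          (\<Sum>i\<in>(\<lambda>k. 2 * k) ` {1..n}. tree_gf $ i * ?D $ (m - i))"
      proof (rule sum.mono_neutral_right)
        show "\<forall>i\<in>{0..m} - (\<lambda>k. 2 * k) ` {1..n}. tree_gf $ i * ?D $ (m - i) = 0"
        proof
          fix i assume i: "i \<in> {0..m} - (\<lambda>k. 2 * k) ` {1..n}"
          have "odd i \<or> i = 0"
          proof (rule ccontr)
            assume "\<not> (odd i \<or> i = 0)"
            then obtain k where "i = 2 * k" "k \<noteq> 0" by (auto elim!: evenE)
            then have "i \<in> (\<lambda>k. 2 * k) ` {1..n}" using i m by auto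
            then show False using i by simp
          qed
          then show "tree_gf $ i * ?D $ (m - i) = 0" by (auto simp: tree_gf_nth_odd)
        qed
      qed (auto simp: m)
      also have "\<dots> = (\<Sum>k=1..n. tree_gf $ (2 * k) * ?D $ (2 * (n - k)))"
        by (subst sum.reindex) (auto simp: inj_on_def m diff_mult_distrib2)
      also have "\<dots> = (\<Sum>k=1..n. real (num_trees k) / fact (2 * k) *
          (real (num_trees (Suc (n - k))) / fact (2 * (n - k))))"
        by (intro sum.cong refl arg_cong2[of _ _ _ _ "(*)"] tree_gf_deriv2_nth_even tree_gf_nth_even)
           simp
      also have "\<dots> = real (num_trees (Suc n)) / fact (2 * n)"
        using False by (intro num_trees_div_fact[symmetric]) simp
      also have "\<dots> = ?D $ m" unfolding m by (rule tree_gf_deriv2_nth_even[symmetric])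
      finally show ?thesis unfolding rhs using False m by simp
    qed
  qed
qed

text \<open>The equation computes coefficient \<open>m + 2\<close> from a convolution of lower
  coefficients.\<close>

lemma fps_ode_unique:
  fixes F H :: "real fps"
  assumes F: "fps_deriv (fps_deriv F) = 1 + F * fps_deriv (fps_deriv F)" "F $ 0 = 0" "F $ 1 = 0"
    and H: "fps_deriv (fps_deriv H) = 1 + H * fps_deriv (fps_deriv H)" "H $ 0 = 0" "H $ 1 = 0"
  shows "F = H"
proof (rule fps_ext)
  fix n show "F $ n = H $ n"
  proof (induction n rule: less_induct)
    case (less n)
    consider "n = 0" | "n = 1" | m where "n = Suc (Suc m)"
      by (metis One_nat_def not0_implies_Suc)
    then show ?case
    proof cases
      case (3 m)
      have nth: "real (Suc m) * (real (Suc (Suc m)) * K $ n) =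
          (if m = 0 then 1 else 0) + (\<Sum>i=0..m. K $ i * fps_deriv (fps_deriv K) $ (m - i))"
        if "fps_deriv (fps_deriv K) = 1 + K * fps_deriv (fps_deriv K)" for K :: "real fps"
        using arg_cong[OF that, of "\<lambda>f. f $ m"] 3 by (simp add: fps_mult_nth del: of_nat_Suc)
      \<comment> \<open>For \<open>i = 0\<close> the second factor would contain the unknown
        coefficient \<open>n\<close> itself; the vanishing constant term removes it. For
        \<open>i > 0\<close> all indices are below \<open>n\<close>.\<close>
      have "F $ i * fps_deriv (fps_deriv F) $ (m - i) = H $ i * fps_deriv (fps_deriv H) $ (m - i)"
        if "i \<le> m" for i
      proof (cases "i = 0")
        case False
        then have "Suc (Suc (m - i)) < n" "i < n" using that 3 by auto
        then show ?thesis using less.IH by simp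
      qed (use F H in simp)
      then have "(\<Sum>i=0..m. F $ i * fps_deriv (fps_deriv F) $ (m - i)) =
          (\<Sum>i=0..m. H $ i * fps_deriv (fps_deriv H) $ (m - i))"
        by (intro sum.cong) auto
      then have "real (Suc m) * (real (Suc (Suc m)) * F $ n) = real (Suc m) * (real (Suc (Suc m)) * H $ n)"
        unfolding nth[OF F(1)] nth[OF H(1)] by simp
      then show ?thesis by (simp del: of_nat_Suc)
    qed (use F H in auto)
  qed
qed

section \<open>The inverse error function as a formal power series\<close>

definition scaled_erf_inv_fps :: "real fps" where
  "scaled_erf_inv_fps = erf_inv_fps oo (fps_const (sqrt 2 / sqrt pi) * fps_X)"

lemma erf_inv_fps_nth_0 [simp]: "erf_inv_fps $ 0 = 0"
  by (simp add: erf_inv_fps_def fps_inv_def)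

lemma scaled_erf_inv_fps_nth_0 [simp]: "scaled_erf_inv_fps $ 0 = 0"
  by (simp add: scaled_erf_inv_fps_def)

lemma erf_fps_deriv:
  "fps_deriv erf_fps = fps_const (2 / sqrt pi) * (fps_exp (- 1) oo fps_X\<^sup>2)"
  by (simp add: erf_fps_def fps_deriv_fps_integral)

text \<open>Reconciles the two ways of writing the exponential of \<open>- f\<close>:
  \<open>erf_fps\<close> is built with \<open>fps_exp (- 1)\<close>, while the closed form of the
  generating function uses \<open>fps_exp 1\<close>.\<close>

lemma fps_exp_neg_compose:
  fixes f :: "real fps"
  assumes "f $ 0 = 0"
  shows "fps_exp (- 1) oo f = (fps_exp 1 oo (- f))"
proof -
  have "fps_exp (- 1) = fps_exp 1 oo (fps_const (- 1) * fps_X :: real fps)"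
    by (subst fps_exp_compose_linear) simp
  then have "fps_exp (- 1) oo f = fps_exp 1 oo ((fps_const (- 1) * fps_X) oo f)"
    using assms by (simp only:) (rule fps_compose_assoc[symmetric], auto)
  also have "(fps_const (- 1) * fps_X) oo f = - f"
    using assms by (simp add: fps_compose_mult_distrib fps_X_fps_compose_startby0)
      (simp add: fps_const_neg[symmetric] del: fps_const_neg)
  finally show ?thesis .
qed

lemma erf_fps_compose_scaled: "erf_fps oo scaled_erf_inv_fps = fps_const (sqrt 2 / sqrt pi) * fps_X"
proof -
  \<comment> \<open>The linear coefficient is \<open>2 / sqrt pi\<close>; being nonzero, it makes
    \<open>fps_inv\<close> a genuine compositional inverse.\<close>
  have "erf_fps $ 0 = 0" "erf_fps $ 1 \<noteq> 0"
    using arg_cong[OF erf_fps_deriv, of "\<lambda>f. f $ 0"] by (auto simp: erf_fps_def)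
  then have "erf_fps oo erf_inv_fps = fps_X"
    unfolding erf_inv_fps_def by (rule fps_inv_right)
  moreover have "erf_fps oo scaled_erf_inv_fps =
      (erf_fps oo erf_inv_fps) oo (fps_const (sqrt 2 / sqrt pi) * fps_X)"
    unfolding scaled_erf_inv_fps_def by (rule fps_compose_assoc) auto
  ultimately show ?thesis by (simp add: fps_X_fps_compose_startby0)
qed

text \<open>Differentiate \<open>erf_fps_compose_scaled\<close> by the chain rule and multiply by
  \<open>sqrt pi / sqrt 2\<close>.\<close>

lemma scaled_erf_inv_fps_deriv:
  "fps_const (sqrt 2) * fps_deriv scaled_erf_inv_fps * (fps_exp 1 oo (- scaled_erf_inv_fps\<^sup>2)) = 1"
proof -
  let ?G = scaled_erf_inv_fps
  have "fps_deriv (erf_fps oo ?G) = fps_const (sqrt 2 / sqrt pi)"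
    unfolding erf_fps_compose_scaled by simp
  moreover have "fps_deriv (erf_fps oo ?G) =
      fps_const (2 / sqrt pi) * (fps_exp 1 oo (- ?G\<^sup>2)) * fps_deriv ?G"
  proof -
    have "(fps_exp (- 1) oo fps_X\<^sup>2) oo ?G = fps_exp (- 1) oo (fps_X\<^sup>2 oo ?G)"
      by (rule fps_compose_assoc[symmetric]) auto
    also have "fps_X\<^sup>2 oo ?G = ?G\<^sup>2"
      by (simp add: fps_compose_power[symmetric] fps_X_fps_compose_startby0)
    also have "fps_exp (- 1) oo ?G\<^sup>2 = fps_exp 1 oo (- ?G\<^sup>2)"
      by (rule fps_exp_neg_compose) simp
    finally show ?thesis
      by (simp add: fps_compose_deriv erf_fps_deriv fps_compose_mult_distrib)
  qed
  ultimately have "fps_const (sqrt pi / sqrt 2) * (fps_const (2 / sqrt pi) *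
      (fps_exp 1 oo (- ?G\<^sup>2)) * fps_deriv ?G) = fps_const (sqrt pi / sqrt 2) * fps_const (sqrt 2 / sqrt pi)"
    by simp
  moreover have "sqrt pi / sqrt 2 * (2 / sqrt pi) = sqrt 2" by (simp add: real_div_sqrt)
  moreover have "sqrt pi / sqrt 2 * (sqrt 2 / sqrt pi) = 1" by simp
  ultimately show ?thesis
    by (metis (no_types, lifting) fps_const_1_eq_1 fps_const_mult mult.assoc mult.commute)
qed

lemma one_minus_exp_deriv:
  "fps_deriv (1 - (fps_exp 1 oo (- scaled_erf_inv_fps\<^sup>2))) = fps_const (sqrt 2) * scaled_erf_inv_fps"
proof -
  let ?G = scaled_erf_inv_fps and ?E = "fps_exp 1 oo (- scaled_erf_inv_fps\<^sup>2)"
  have "fps_deriv (1 - ?E) = 2 * ?G * (fps_deriv ?G * ?E)"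
    by (simp add: fps_compose_deriv fps_deriv_power algebra_simps)
  \<comment> \<open>Splitting 2 into two factors \<open>sqrt 2\<close> isolates the product that
    \<open>scaled_erf_inv_fps_deriv\<close> evaluates to 1.\<close>
  also have "2 = fps_const (sqrt 2) * (fps_const (sqrt 2) :: real fps)"
    by (simp add: numeral_fps_const)
  also have "fps_const (sqrt 2) * fps_const (sqrt 2) * ?G * (fps_deriv ?G * ?E) =
      fps_const (sqrt 2) * ?G * (fps_const (sqrt 2) * fps_deriv ?G * ?E)"
    by (simp only: mult_ac)
  finally show ?thesis unfolding scaled_erf_inv_fps_deriv by simp
qed

lemma tree_gf_eq_exp: "tree_gf = 1 - (fps_exp 1 oo (- scaled_erf_inv_fps\<^sup>2))"
proof (rule fps_ode_unique)
  let ?F = "1 - (fps_exp 1 oo (- scaled_erf_inv_fps\<^sup>2))"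
  have D: "fps_deriv (fps_deriv ?F) = fps_const (sqrt 2) * fps_deriv scaled_erf_inv_fps"
    unfolding one_minus_exp_deriv by simp
  show "fps_deriv (fps_deriv ?F) = 1 + ?F * fps_deriv (fps_deriv ?F)"
    unfolding D using scaled_erf_inv_fps_deriv by (simp add: algebra_simps)
  show "?F $ 0 = 0" by simp
  show "?F $ 1 = 0" using arg_cong[OF one_minus_exp_deriv, of "\<lambda>f. f $ 0"] by simp
qed (use tree_gf_ode in simp_all)

text \<open>Both sides have derivative \<open>fps_const (sqrt 2) * scaled_erf_inv_fps\<close> and no
  constant term.\<close>

lemma tree_gf_eq_integral:
  "tree_gf = fps_const (sqrt pi) *
     (fps_integral0 erf_inv_fps oo (fps_const (sqrt 2 / sqrt pi) * fps_X))" (is "_ = ?I")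
proof -
  have "fps_deriv ?I = fps_const (sqrt pi) * (scaled_erf_inv_fps * fps_const (sqrt 2 / sqrt pi))"
    by (simp add: fps_compose_deriv fps_deriv_fps_integral scaled_erf_inv_fps_def)
  also have "\<dots> = fps_const (sqrt 2) * scaled_erf_inv_fps"
    by (simp add: fps_eq_iff)
  finally have "fps_deriv tree_gf = fps_deriv ?I"
    unfolding tree_gf_eq_exp one_minus_exp_deriv by simp
  then have "tree_gf = fps_const (tree_gf $ 0 - ?I $ 0) + ?I"
    by (simp only: fps_deriv_eq_iff)
  then show ?thesis by simp
qed

text \<open>With T_{n+1} divided by (2n)! and \<open>k = m + 1\<close>, the tree recurrence turns
  into that for \<open>erf_inv_coeff\<close>: the weight (m+1)(2m+1) arises from passing from (2m)!
  to (2m+2)!.\<close>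

lemma num_trees_eq_erf_inv_coeff:
  "real (num_trees (Suc n)) = fact (2 * n) / 2 ^ n * erf_inv_coeff n"
proof (induction n rule: less_induct)
  case (less n)
  show ?case
  proof (cases "n = 0")
    case True
    then show ?thesis using num_trees_1 by (simp add: erf_inv_coeff.simps)
  next
    case False
    have "real (num_trees (Suc n)) / fact (2 * n) =
      (\<Sum>k=1..n. real (num_trees k) / fact (2 * k) *
         (real (num_trees (Suc (n - k))) / fact (2 * (n - k))))"
      using False by (intro num_trees_div_fact) simp
    also have "\<dots> = (\<Sum>m<n. real (num_trees (Suc m)) / fact (2 * Suc m) *
         (real (num_trees (Suc (n - 1 - m))) / fact (2 * (n - 1 - m))))"
      by (rule sum.reindex_bij_witness[of _ Suc "\<lambda>k. k - 1"]) auto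
    also have "\<dots> = (\<Sum>m<n. erf_inv_coeff m * erf_inv_coeff (n - 1 - m) /
         ((real m + 1) * (2 * real m + 1)) / 2 ^ n)"
    proof (rule sum.cong[OF refl])
      fix m assume "m \<in> {..<n}"
      then have m: "m < n" "n - 1 - m < n" by auto
      have "real (num_trees (Suc m)) / fact (2 * Suc m) =
          erf_inv_coeff m / (2 ^ Suc m * ((real m + 1) * (2 * real m + 1)))"
        unfolding less.IH[OF m(1)] fact_double_Suc by (simp del: mult_Suc_right)
      moreover have "real (num_trees (Suc (n - 1 - m))) / fact (2 * (n - 1 - m)) =
          erf_inv_coeff (n - 1 - m) / 2 ^ (n - 1 - m)"
        unfolding less.IH[OF m(2)] by simp
      \<comment> \<open>The factor 2 in \<open>fact_double_Suc\<close> raises the first exponent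
        from \<open>m\<close> to \<open>Suc m\<close>, so the two exponents add up to
        \<open>n\<close>.\<close>
      moreover have "2 ^ n = 2 ^ Suc m * (2 ^ (n - 1 - m) :: real)"
        using m by (simp flip: power_add power_Suc)
      ultimately show "real (num_trees (Suc m)) / fact (2 * Suc m) *
         (real (num_trees (Suc (n - 1 - m))) / fact (2 * (n - 1 - m))) =
         erf_inv_coeff m * erf_inv_coeff (n - 1 - m) / ((real m + 1) * (2 * real m + 1)) / 2 ^ n"
        by (simp only: times_divide_times_eq divide_divide_eq_left mult_ac)
    qed
    also have "\<dots> = erf_inv_coeff n / 2 ^ n"
      using False by (subst (3) erf_inv_coeff.simps) (simp add: sum_divide_distrib)
    finally show ?thesis by (simp add: field_simps)
  qed
qed

section \<open>The error function and its inverse\<close>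

lemma erf_0 [simp]: "erf 0 = 0"
  by (simp add: erf_def flip: zero_ereal_def)

lemma DERIV_erf: "(erf has_real_derivative 2 / sqrt pi * exp (- x\<^sup>2)) (at x)"
proof -
  \<comment> \<open>This compact interval contains 0 and has \<open>x\<close> in its interior, so
    the one from the fundamental theorem is a full derivative.\<close>
  let ?a = "- (\<bar>x\<bar> + 1)" and ?b = "\<bar>x\<bar> + 1"
  have "((\<lambda>u. LBINT y=ereal 0..ereal u. exp (- y\<^sup>2)) has_vector_derivative exp (- x\<^sup>2))
      (at x within {?a..?b})"
    by (intro interval_integral_FTC2 continuous_intros) auto
  then have "((\<lambda>u. LBINT y=0..ereal u. exp (- y\<^sup>2)) has_real_derivative exp (- x\<^sup>2))
      (at x within {?a..?b})"
    by (simp add: has_real_derivative_iff_has_vector_derivative flip: zero_ereal_def)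
  moreover have "at x within {?a..?b} = at x"
    by (intro at_within_interior) auto
  ultimately have "((\<lambda>u. LBINT y=0..ereal u. exp (- y\<^sup>2)) has_real_derivative exp (- x\<^sup>2)) (at x)"
    by simp
  then show ?thesis
    unfolding erf_def[abs_def] by (rule DERIV_cmult)
qed

lemma DERIV_erf_chain [derivative_intros]:
  "(f has_real_derivative f') (at x within A) \<Longrightarrow>
   ((\<lambda>x. erf (f x)) has_real_derivative 2 / sqrt pi * exp (- (f x)\<^sup>2) * f') (at x within A)"
  by (rule DERIV_chain2[OF DERIV_erf])

lemma erf_strict_mono: "strict_mono erf"
proof (rule strict_monoI)
  fix x y :: real assume "x < y"
  then show "erf x < erf y"
  proof (rule DERIV_pos_imp_increasing)
    show "\<exists>d. (erf has_real_derivative d) (at u) \<and> d > 0" for u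
      by (rule exI, rule conjI, rule DERIV_erf) simp
  qed
qed

lemma erf_minus: "erf (- x) = - erf x"
proof -
  have "((\<lambda>x. erf x + erf (- x)) has_real_derivative 0) (at y)" for y
    by (auto intro!: derivative_eq_intros)
  then have "erf x + erf (- x) = erf 0 + erf (- 0)"
    by (intro DERIV_isconst_all[of "\<lambda>x. erf x + erf (- x)"]) auto
  then show ?thesis by simp
qed

text \<open>The Gaussian integral over the half line equals \<open>sqrt pi / 2\<close>.\<close>

lemma erf_at_top: "(erf \<longlongrightarrow> 1) at_top"
proof -
  let ?f = "\<lambda>x::real. indicator {0..} x *\<^sub>R exp (- x\<^sup>2)"
  have "((\<lambda>z. LBINT x. indicator {..z} x *\<^sub>R ?f x) \<longlongrightarrow> (LBINT x. ?f x)) at_top"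
    using gaussian_moment_0 by (intro tendsto_integral_at_top) (auto simp: has_bochner_integral_iff)
  also have "(LBINT x. ?f x) = sqrt pi / 2"
    using gaussian_moment_0 by (simp add: has_bochner_integral_iff)
  finally have "((\<lambda>z. 2 / sqrt pi * (LBINT x. indicator {..z} x *\<^sub>R ?f x)) \<longlongrightarrow>
      2 / sqrt pi * (sqrt pi / 2)) at_top"
    by (intro tendsto_intros)
  moreover have "\<forall>\<^sub>F z in at_top. 2 / sqrt pi * (LBINT x. indicator {..z} x *\<^sub>R ?f x) = erf z"
    using eventually_ge_at_top[of "0::real"]
  proof eventually_elim
    case (elim z)
    have "(LBINT x=ereal 0..ereal z. exp (- x\<^sup>2)) = (LBINT x. indicator {..z} x *\<^sub>R ?f x)"
      unfolding interval_integral_Icc[OF elim] set_lebesgue_integral_def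
      by (intro Bochner_Integration.integral_cong) (auto simp: indicator_def)
    then show ?case by (simp add: erf_def flip: zero_ereal_def)
  qed
  ultimately show ?thesis by (simp add: tendsto_cong)
qed

text \<open>The limit at infinity provides \<open>b\<close> with \<open>erf b\<close> above the
  modulus of \<open>y\<close>; by oddness \<open>erf\<close> passes through \<open>y\<close> between
  \<open>- b\<close> and \<open>b\<close>.\<close>

lemma erf_erf_inv:
  assumes "\<bar>y\<bar> < 1"
  shows "erf (erf_inv y) = y"
proof -
  have "\<forall>\<^sub>F b in at_top. erf b > \<bar>y\<bar>"
    using erf_at_top assms by (rule order_tendstoD(1))
  then obtain b where b: "erf b > \<bar>y\<bar>" by (auto simp: eventually_at_top_linorder)
  then have "erf (- b) \<le> y" "y \<le> erf b" using erf_minus[of b] by auto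
  moreover have "- b \<le> b"
    using erf_minus[of b] b strict_mono_less_eq[OF erf_strict_mono, of "- b" b] by linarith
  ultimately have "\<exists>x. - b \<le> x \<and> x \<le> b \<and> erf x = y"
    by (intro IVT allI impI) (auto intro: DERIV_isCont DERIV_erf)
  then have "y \<in> range erf" by auto
  then show ?thesis unfolding erf_inv_def by (rule f_inv_into_f)
qed

lemma erf_inv_erf [simp]: "erf_inv (erf x) = x"
  unfolding erf_inv_def by (rule inv_f_f) (rule strict_mono_imp_inj_on[OF erf_strict_mono])

lemma erf_inv_0 [simp]: "erf_inv 0 = 0"
  using erf_inv_erf[of 0] by simp

lemma DERIV_erf_inv:
  assumes "\<bar>y\<bar> < 1"
  shows "(erf_inv has_real_derivative sqrt pi / 2 * exp ((erf_inv y)\<^sup>2)) (at y)"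
proof -
  let ?x = "erf_inv y" and ?D = "2 / sqrt pi * exp (- (erf_inv y)\<^sup>2)"
  have D: "?D \<noteq> 0" by simp
  \<comment> \<open>The inverse function rule yields the derivative at \<open>erf ?x\<close>, and
    this point is \<open>y\<close> by \<open>erf_erf_inv\<close>.\<close>
  have "(erf_inv has_derivative (*) (inverse ?D)) (at (erf ?x))"
  proof (rule has_derivative_inverse_strong[where S = UNIV and f = erf and x = ?x])
    show "continuous_on UNIV erf"
      by (intro continuous_at_imp_continuous_on ballI DERIV_isCont[OF DERIV_erf])
    show "(erf has_derivative (*) ?D) (at ?x)"
      using DERIV_erf[of ?x] unfolding has_field_derivative_def .
    show "(*) ?D \<circ> (*) (inverse ?D) = id" using D by (auto simp: fun_eq_iff)
  qed auto
  then have "(erf_inv has_real_derivative inverse ?D) (at y)"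
    unfolding has_field_derivative_def erf_erf_inv[OF assms] .
  also have "inverse ?D = sqrt pi / 2 * exp ((erf_inv y)\<^sup>2)" by (simp add: exp_minus field_simps)
  finally show ?thesis .
qed

text \<open>In the derivative of the left side the factor \<open>exp ((erf_inv x)\<^sup>2)\<close>
  of the derivative of \<open>erf_inv\<close> cancels, leaving \<open>sqrt pi * erf_inv x\<close>.
  Taking \<open>min\<close> and \<open>max\<close> with 0 covers both signs of
  \<open>y\<close>.\<close>

lemma exp_erf_inv_eq_integral:
  assumes "\<bar>y\<bar> < 1"
  shows "1 - exp (- ((erf_inv y)\<^sup>2)) = sqrt pi * (LBINT x=0..ereal y. erf_inv x)"
proof -
  let ?F = "\<lambda>x. (1 - exp (- ((erf_inv x)\<^sup>2))) / sqrt pi"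
  have lt: "\<bar>x\<bar> < 1" if "min 0 y \<le> x" "x \<le> max 0 y" for x using that assms by auto
  have D: "(?F has_real_derivative erf_inv x) (at x)" if "\<bar>x\<bar> < 1" for x
    using DERIV_erf_inv[OF that]
    by (auto intro!: derivative_eq_intros simp: exp_minus field_simps)
  have "(LBINT x=ereal 0..ereal y. erf_inv x) = ?F y - ?F 0"
  proof (rule interval_integral_FTC_finite)
    show "continuous_on {min 0 y..max 0 y} erf_inv"
      using lt by (intro continuous_at_imp_continuous_on ballI DERIV_isCont[OF DERIV_erf_inv]) auto
    show "(?F has_vector_derivative erf_inv x) (at x within {min 0 y..max 0 y})"
      if "min 0 y \<le> x" "x \<le> max 0 y" for x
      using D[OF lt[OF that]] has_vector_derivative_at_within
      unfolding has_real_derivative_iff_has_vector_derivative by blast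
  qed
  then show ?thesis by (simp flip: zero_ereal_def)
qed

lemma scaling_less_1:
  assumes "\<bar>z\<bar> < sqrt (pi / 2)"
  shows "\<bar>sqrt 2 / sqrt pi * z\<bar> < 1"
proof -
  have "\<bar>sqrt 2 / sqrt pi * z\<bar> = sqrt 2 / sqrt pi * \<bar>z\<bar>" by (simp add: abs_mult)
  also have "\<dots> < sqrt 2 / sqrt pi * sqrt (pi / 2)"
    using assms by (intro mult_strict_left_mono) auto
  also have "\<dots> = 1" by (simp add: real_sqrt_divide)
  finally show ?thesis .
qed

section \<open>The scaled inverse error function and its differential equation\<close>

definition scaled_erf_inv :: "real \<Rightarrow> real" where
  "scaled_erf_inv z = erf_inv (sqrt 2 / sqrt pi * z)"

lemma scaled_erf_inv_0 [simp]: "scaled_erf_inv 0 = 0"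
  by (simp add: scaled_erf_inv_def)

lemma DERIV_scaled_erf_inv:
  assumes "\<bar>z\<bar> < sqrt (pi / 2)"
  shows "((\<lambda>z. sqrt 2 * scaled_erf_inv z) has_real_derivative exp ((scaled_erf_inv z)\<^sup>2)) (at z)"
proof -
  have "((\<lambda>z. sqrt 2 / sqrt pi * z) has_real_derivative sqrt 2 / sqrt pi) (at z)"
    using DERIV_cmult[OF DERIV_ident, of "sqrt 2 / sqrt pi"] by (simp only: mult_1_right)
  from DERIV_cmult[OF DERIV_chain2[OF DERIV_erf_inv[OF scaling_less_1[OF assms]] this], of "sqrt 2"]
  have "((\<lambda>z. sqrt 2 * scaled_erf_inv z) has_real_derivative
      sqrt 2 * (sqrt pi / 2 * exp ((scaled_erf_inv z)\<^sup>2) * (sqrt 2 / sqrt pi))) (at z)"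
    unfolding scaled_erf_inv_def .
  also have "sqrt 2 * (sqrt pi / 2 * exp ((scaled_erf_inv z)\<^sup>2) * (sqrt 2 / sqrt pi)) =
      (sqrt 2 * sqrt 2 / 2) * (sqrt pi / sqrt pi) * exp ((scaled_erf_inv z)\<^sup>2)"
    by (simp only: times_divide_eq_left times_divide_eq_right divide_divide_eq_left mult_ac)
  finally show ?thesis by simp
qed

lemma DERIV_exp_scaled_erf_inv:
  assumes "\<bar>z\<bar> < sqrt (pi / 2)"
  shows "((\<lambda>z. 1 - exp (- (scaled_erf_inv z)\<^sup>2)) has_real_derivative sqrt 2 * scaled_erf_inv z) (at z)"
proof -
  let ?g = scaled_erf_inv
  \<comment> \<open>Writing the exponent in terms of \<open>sqrt 2 * ?g z\<close> lets
    \<open>DERIV_scaled_erf_inv\<close> apply as stated.\<close>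
  have "((\<lambda>z. 1 - exp (- ((sqrt 2 * ?g z)\<^sup>2 / 2))) has_real_derivative
      exp (- ((sqrt 2 * ?g z)\<^sup>2 / 2)) * (sqrt 2 * ?g z * exp ((?g z)\<^sup>2))) (at z)"
    by (rule derivative_eq_intros DERIV_scaled_erf_inv[OF assms] refl | simp)+
  moreover have "exp (- (?g z)\<^sup>2) * (sqrt 2 * ?g z * exp ((?g z)\<^sup>2)) = sqrt 2 * ?g z"
    by (simp add: exp_minus)
  ultimately show ?thesis by (simp add: power_mult_distrib)
qed

section \<open>Convergence of the generating function\<close>

definition fps_partial_sum :: "real fps \<Rightarrow> nat \<Rightarrow> real \<Rightarrow> real" where
  "fps_partial_sum F N x = (\<Sum>m<N. F $ m * x ^ m)"

lemma fps_partial_sum_at_0: "fps_partial_sum F (Suc N) 0 = F $ 0"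
  unfolding fps_partial_sum_def by (subst sum.lessThan_Suc_shift) simp

lemma DERIV_fps_partial_sum:
  "(fps_partial_sum F (Suc N) has_real_derivative fps_partial_sum (fps_deriv F) N x) (at x)"
proof -
  have "((\<lambda>x. F $ 0 + (\<Sum>m<N. F $ Suc m * x ^ Suc m)) has_real_derivative
      (\<Sum>m<N. F $ Suc m * (real (Suc m) * x ^ m))) (at x)"
    by (auto intro!: derivative_eq_intros sum.cong simp del: power_Suc)
  then show ?thesis
    unfolding fps_partial_sum_def[abs_def] sum.lessThan_Suc_shift
    by (simp add: mult_ac)
qed

text \<open>The point is that \<open>H\<close> is truncated at \<open>N\<close> and not at
  \<open>Suc N\<close>, which is what an induction on the length of the partial sums of T'' can
  use.\<close>

lemma fps_partial_sum_mult_le: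
  assumes F: "\<And>m. F $ m \<ge> 0" "F $ 0 = 0" and H: "\<And>m. H $ m \<ge> 0" and x: "x \<ge> 0"
  shows "fps_partial_sum (F * H) (Suc N) x \<le>
    fps_partial_sum F (Suc (Suc N)) x * fps_partial_sum H N x"
proof -
  define t where "t i j = (F $ i * x ^ i) * (H $ j * x ^ j)" for i j
  let ?T = "{(i, j). i + j < Suc N}"
  have nonneg: "t i j \<ge> 0" for i j using F H x by (simp add: t_def)
  have fin: "finite ?T" by (rule finite_subset[of _ "{..N} \<times> {..N}"]) auto
  have "fps_partial_sum (F * H) (Suc N) x = (\<Sum>m<Suc N. \<Sum>i\<le>m. t i (m - i))"
    unfolding fps_partial_sum_def
  proof (rule sum.cong[OF refl])
    fix m
    have "(F * H) $ m * x ^ m = (\<Sum>i\<le>m. F $ i * H $ (m - i) * x ^ m)"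
      by (simp add: fps_mult_nth atLeast0AtMost sum_distrib_right)
    also have "\<dots> = (\<Sum>i\<le>m. t i (m - i))"
    proof (rule sum.cong[OF refl])
      fix i assume "i \<in> {..m}"
      then have "x ^ m = x ^ i * x ^ (m - i)" by (simp flip: power_add)
      then show "F $ i * H $ (m - i) * x ^ m = t i (m - i)" by (simp add: t_def mult_ac)
    qed
    finally show "(F * H) $ m * x ^ m = (\<Sum>i\<le>m. t i (m - i))" .
  qed
  also have "\<dots> = (\<Sum>(i, j)\<in>?T. t i j)" by (rule sum.triangle_reindex[symmetric])
  \<comment> \<open>Since \<open>F\<close> has no constant term only \<open>i > 0\<close> matters;
    then \<open>i + j < Suc N\<close> gives \<open>j < N\<close>, so the triangle fits into the
    rectangle below.\<close>
  also have "\<dots> = (\<Sum>(i, j)\<in>{p \<in> ?T. fst p \<noteq> 0}. t i j)"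
    by (rule sum.mono_neutral_right) (use fin F in \<open>auto simp: t_def intro!: gr0I\<close>)
  also have "\<dots> \<le> (\<Sum>(i, j)\<in>{..<Suc (Suc N)} \<times> {..<N}. t i j)"
    by (rule sum_mono2) (use nonneg in auto)
  also have "\<dots> = fps_partial_sum F (Suc (Suc N)) x * fps_partial_sum H N x"
    unfolding fps_partial_sum_def sum_product sum.cartesian_product t_def ..
  finally show ?thesis .
qed

text \<open>
  The function \<open>f = 1 - exp (- g\<^sup>2)\<close> with \<open>g = scaled_erf_inv\<close> solves \<open>f'' = 1 + f f''\<close>.
  Truncating the product on the right of the same equation for the generating function only
  loses nonnegative terms, so a bound for \<open>S\<^sub>N''\<close> by \<open>f''\<close> propagates to \<open>S\<^sub>N\<^sub>+\<^sub>1''\<close>.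
\<close>

lemma tree_gf_partial_sum_le:
  assumes "0 \<le> x" "x < sqrt (pi / 2)"
  shows "fps_partial_sum tree_gf (Suc (Suc N)) x \<le> 1 - exp (- (scaled_erf_inv x)\<^sup>2)"
proof -
  let ?g = scaled_erf_inv and ?D1 = "fps_deriv tree_gf" and ?D2 = "fps_deriv (fps_deriv tree_gf)"
  \<comment> \<open>Two integrations from 0 carry a bound on \<open>N\<close> terms of T'' to
    \<open>N + 2\<close> terms of T: each difference vanishes at 0 and has a nonnegative
    derivative.\<close>
  have integrate: "fps_partial_sum tree_gf (Suc (Suc N)) x \<le> 1 - exp (- (?g x)\<^sup>2)"
    if bound: "\<And>x. 0 \<le> x \<Longrightarrow> x < sqrt (pi / 2) \<Longrightarrow> fps_partial_sum ?D2 N x \<le> exp ((?g x)\<^sup>2)"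
      and x: "0 \<le> x" "x < sqrt (pi / 2)" for N x
  proof -
    have first: "fps_partial_sum ?D1 (Suc N) y \<le> sqrt 2 * ?g y" if y: "0 \<le> y" "y < sqrt (pi / 2)" for y
    proof -
      have "sqrt 2 * ?g 0 - fps_partial_sum ?D1 (Suc N) 0 \<le>
          sqrt 2 * ?g y - fps_partial_sum ?D1 (Suc N) y"
      proof (rule DERIV_nonneg_imp_nondecreasing[OF y(1)])
        fix u assume u: "0 \<le> u" "u \<le> y"
        then have "\<bar>u\<bar> < sqrt (pi / 2)" using y by simp
        from DERIV_diff[OF DERIV_scaled_erf_inv[OF this] DERIV_fps_partial_sum[of ?D1 N]]
        show "\<exists>d. ((\<lambda>u. sqrt 2 * ?g u - fps_partial_sum ?D1 (Suc N) u) has_real_derivative d) (at u)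
            \<and> 0 \<le> d"
          using bound[of u] u y by auto
      qed
      then show ?thesis by (simp add: fps_partial_sum_at_0)
    qed
    have "1 - exp (- (?g 0)\<^sup>2) - fps_partial_sum tree_gf (Suc (Suc N)) 0 \<le>
        1 - exp (- (?g x)\<^sup>2) - fps_partial_sum tree_gf (Suc (Suc N)) x"
    proof (rule DERIV_nonneg_imp_nondecreasing[OF x(1)])
      fix u assume u: "0 \<le> u" "u \<le> x"
      then have "\<bar>u\<bar> < sqrt (pi / 2)" using x by simp
      from DERIV_diff[OF DERIV_exp_scaled_erf_inv[OF this] DERIV_fps_partial_sum[of tree_gf "Suc N"]]
      show "\<exists>d. ((\<lambda>u. 1 - exp (- (?g u)\<^sup>2) - fps_partial_sum tree_gf (Suc (Suc N)) u)
          has_real_derivative d) (at u) \<and> 0 \<le> d"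
        using first[of u] u x by auto
    qed
    then show ?thesis by (simp add: fps_partial_sum_at_0)
  qed
  have D2_nonneg: "?D2 $ m \<ge> 0" for m
    using tree_gf_nth_nonneg by simp
  have bound: "fps_partial_sum ?D2 N x \<le> exp ((?g x)\<^sup>2)" if "0 \<le> x" "x < sqrt (pi / 2)" for N x
    using that
  proof (induction N arbitrary: x)
    case 0
    then show ?case by (simp add: fps_partial_sum_def)
  next
    case (Suc N)
    have "fps_partial_sum ?D2 (Suc N) x = fps_partial_sum (1 + tree_gf * ?D2) (Suc N) x"
      by (simp only: flip: tree_gf_ode)
    also have "\<dots> = fps_partial_sum 1 (Suc N) x + fps_partial_sum (tree_gf * ?D2) (Suc N) x"
      by (simp only: fps_partial_sum_def fps_add_nth distrib_right sum.distrib)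
    also have "fps_partial_sum 1 (Suc N) x = 1"
      unfolding fps_partial_sum_def by (subst sum.lessThan_Suc_shift) simp
    also have "fps_partial_sum (tree_gf * ?D2) (Suc N) x \<le>
        fps_partial_sum tree_gf (Suc (Suc N)) x * fps_partial_sum ?D2 N x"
      using Suc.prems D2_nonneg by (intro fps_partial_sum_mult_le tree_gf_nth_nonneg) auto
    also have "\<dots> \<le> (1 - exp (- (?g x)\<^sup>2)) * exp ((?g x)\<^sup>2)"
      using Suc.prems D2_nonneg
      by (intro mult_mono integrate Suc.IH)
         (auto simp: fps_partial_sum_def simp del: fps_deriv_nth intro!: sum_nonneg)
    \<comment> \<open>The induction closes without loss because the comparison function satisfies
      the same equation.\<close>
    also have "1 + \<dots> = exp ((?g x)\<^sup>2)" by (simp add: algebra_simps flip: exp_add)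
    finally show ?case by simp
  qed
  show "fps_partial_sum tree_gf (Suc (Suc N)) x \<le> 1 - exp (- (?g x)\<^sup>2)"
    using bound assms by (rule integrate)
qed

text \<open>With nonnegative coefficients, bounded partial sums at a positive \<open>r\<close>
  already give summability.\<close>

lemma tree_gf_conv_radius: "fps_conv_radius tree_gf \<ge> sqrt (pi / 2)"
  unfolding fps_conv_radius_def
proof (rule conv_radius_geI_ex')
  fix r :: real assume r: "0 < r" "ereal r < ereal (sqrt (pi / 2))"
  have nonneg: "tree_gf $ n * r ^ n \<ge> 0" for n using r tree_gf_nth_nonneg by simp
  have "summable (\<lambda>n. tree_gf $ n * r ^ n)"
  proof (rule summableI_nonneg_bounded[OF nonneg])
    fix N
    have "(\<Sum>n<N. tree_gf $ n * r ^ n) \<le> fps_partial_sum tree_gf (Suc (Suc N)) r"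
      unfolding fps_partial_sum_def by (rule sum_mono2) (use nonneg in auto)
    also have "\<dots> \<le> 1 - exp (- (scaled_erf_inv r)\<^sup>2)"
      using r by (intro tree_gf_partial_sum_le) auto
    finally show "(\<Sum>n<N. tree_gf $ n * r ^ n) \<le> 1 - exp (- (scaled_erf_inv r)\<^sup>2)" .
  qed
  then show "summable (\<lambda>n. tree_gf $ n * of_real r ^ n)" by simp
qed

text \<open>
  On the interval of convergence \<open>(1 - T) exp (T'\<^sup>2 / 2)\<close> is a first integral of \<open>T'' (1 - T) = 1\<close>,
  hence \<open>erf (T' / sqrt 2)\<close> has constant derivative.
\<close>

lemma eval_tree_gf:
  assumes z: "\<bar>z\<bar> < sqrt (pi / 2)"
  shows "eval_fps tree_gf z = 1 - exp (- (scaled_erf_inv z)\<^sup>2)"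
proof -
  define b where "b = sqrt (pi / 2)"
  let ?D1 = "fps_deriv tree_gf"
  let ?T = "eval_fps tree_gf" and ?T1 = "eval_fps ?D1" and ?T2 = "eval_fps (fps_deriv ?D1)"
  have b: "b > 0" by (simp add: b_def)
  have rad: "ereal (norm x) < fps_conv_radius tree_gf" "ereal (norm x) < fps_conv_radius ?D1"
    "ereal (norm x) < fps_conv_radius (fps_deriv ?D1)" if "x \<in> {- b<..<b}" for x
  proof -
    have "ereal (norm x) < ereal b" using that by auto
    also have "\<dots> \<le> fps_conv_radius tree_gf" unfolding b_def by (rule tree_gf_conv_radius)
    finally show 1: "ereal (norm x) < fps_conv_radius tree_gf" .
    also note fps_conv_radius_deriv
    finally show 2: "ereal (norm x) < fps_conv_radius ?D1" .
    also note fps_conv_radius_deriv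
    finally show "ereal (norm x) < fps_conv_radius (fps_deriv ?D1)" .
  qed
  have T: "(?T has_real_derivative ?T1 x) (at x)" and T1: "(?T1 has_real_derivative ?T2 x) (at x)"
    if "x \<in> {- b<..<b}" for x
    using rad[OF that] by (auto intro: has_field_derivative_eval_fps)
  have ode: "(1 - ?T x) * ?T2 x = 1" if x: "x \<in> {- b<..<b}" for x
  proof -
    note r = rad[OF x]
    have "ereal (norm x) < fps_conv_radius (tree_gf * fps_deriv ?D1)"
      using r(1,3) fps_conv_radius_mult by (meson less_le_trans min_less_iff_conj)
    then have "eval_fps (1 + tree_gf * fps_deriv ?D1) x = 1 + ?T x * ?T2 x"
      using r by (simp add: eval_fps_add eval_fps_mult)
    then show ?thesis by (simp add: algebra_simps flip: tree_gf_ode)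
  qed
  have mem: "0 \<in> {- b<..<b}" "z \<in> {- b<..<b}" using b z by (auto simp: b_def)
  have integral: "1 - ?T x = exp (- ((?T1 x)\<^sup>2 / 2))" if x: "x \<in> {- b<..<b}" for x
  proof -
    have "(1 - ?T x) * exp ((?T1 x)\<^sup>2 / 2) = (1 - ?T 0) * exp ((?T1 0)\<^sup>2 / 2)"
    proof (rule DERIV_isconst3[of "- b" b x 0 "\<lambda>x. (1 - ?T x) * exp ((?T1 x)\<^sup>2 / 2)"])
      fix y assume y: "y \<in> {- b<..<b}"
      \<comment> \<open>The derivative is arranged so that the differential equation appears as the
        vanishing factor \<open>(1 - ?T y) * ?T2 y - 1\<close>.\<close>
      have "((\<lambda>x. (1 - ?T x) * exp ((?T1 x)\<^sup>2 / 2)) has_real_derivative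
          ((1 - ?T y) * ?T2 y - 1) * ?T1 y * exp ((?T1 y)\<^sup>2 / 2)) (at y)"
        by (rule derivative_eq_intros T[OF y] T1[OF y] refl | simp add: algebra_simps)+
      then show "((\<lambda>x. (1 - ?T x) * exp ((?T1 x)\<^sup>2 / 2)) has_real_derivative 0) (at y)"
        using ode[OF y] by simp
    qed (use b x mem in auto)
    also have "\<dots> = 1" by (simp add: eval_fps_at_0)
    finally show ?thesis by (simp add: exp_minus field_simps)
  qed
  have "erf (?T1 z / sqrt 2) - sqrt 2 / sqrt pi * z = erf (?T1 0 / sqrt 2) - sqrt 2 / sqrt pi * 0"
  proof (rule DERIV_isconst3[of "- b" b z 0 "\<lambda>x. erf (?T1 x / sqrt 2) - sqrt 2 / sqrt pi * x"])
    fix y assume y: "y \<in> {- b<..<b}"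
    have "((\<lambda>x. erf (?T1 x / sqrt 2) - sqrt 2 / sqrt pi * x) has_real_derivative
        2 / sqrt pi * exp (- (?T1 y / sqrt 2)\<^sup>2) * (?T2 y / sqrt 2) - sqrt 2 / sqrt pi) (at y)"
      using DERIV_diff[OF DERIV_erf_chain[OF DERIV_cdivide[OF T1[OF y], of "sqrt 2"]]
          DERIV_cmult[OF DERIV_ident, of "sqrt 2 / sqrt pi"]] by (simp only: mult_1_right)
    also have "- (?T1 y / sqrt 2)\<^sup>2 = - ((?T1 y)\<^sup>2 / 2)" by (simp add: power_divide)
    \<comment> \<open>The first integral replaces the exponential by \<open>1 - ?T y\<close>, whose
      product with \<open>?T2 y\<close> is 1.\<close>
    also have "2 / sqrt pi * exp (- ((?T1 y)\<^sup>2 / 2)) * (?T2 y / sqrt 2) =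
        2 / sqrt 2 / sqrt pi * ((1 - ?T y) * ?T2 y)"
      unfolding integral[OF y] by (simp add: mult_ac)
    also have "2 / sqrt 2 / sqrt pi * ((1 - ?T y) * ?T2 y) = sqrt 2 / sqrt pi"
      unfolding ode[OF y] by (simp add: real_div_sqrt)
    finally show "((\<lambda>x. erf (?T1 x / sqrt 2) - sqrt 2 / sqrt pi * x) has_real_derivative 0) (at y)"
      by simp
  qed (use b mem in auto)
  then have "erf (?T1 z / sqrt 2) = sqrt 2 / sqrt pi * z" by (simp add: eval_fps_at_0)
  \<comment> \<open>Applying \<open>erf_inv\<close> identifies T' with \<open>sqrt 2\<close> times
    \<open>scaled_erf_inv\<close>; the first integral then gives the value of T.\<close>
  then have "scaled_erf_inv z = ?T1 z / sqrt 2"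
    unfolding scaled_erf_inv_def by (metis erf_inv_erf)
  then show ?thesis using integral[OF mem(2)] by (simp add: power_divide)
qed

text \<open>Passes from the power series over all exponents to its subsequence of positive even
  ones, outside which the coefficients vanish.\<close>

lemma tree_series_sums:
  assumes "\<bar>z\<bar> < sqrt (pi / 2)"
  shows "(\<lambda>n. real (num_trees (n + 1)) * z ^ (2 * (n + 1)) / fact (2 * (n + 1))) sums
    (1 - exp (- (scaled_erf_inv z)\<^sup>2))"
proof -
  have "ereal (norm z) < fps_conv_radius tree_gf"
    using assms tree_gf_conv_radius by (metis less_ereal.simps(1) order_less_le_trans real_norm_def)
  then have "(\<lambda>m. tree_gf $ m * z ^ m) sums (1 - exp (- (scaled_erf_inv z)\<^sup>2))"
    using sums_eval_fps eval_tree_gf[OF assms] by metis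
  moreover have "strict_mono (\<lambda>n::nat. 2 * (n + 1))" by (rule strict_monoI) simp
  moreover have "tree_gf $ m * z ^ m = 0" if "m \<notin> range (\<lambda>n. 2 * (n + 1))" for m
  proof -
    have "odd m \<or> m = 0"
    proof (rule ccontr)
      assume "\<not> (odd m \<or> m = 0)"
      then obtain k where "m = 2 * k" "k \<noteq> 0" by (auto elim!: evenE)
      then have "m = 2 * ((k - 1) + 1)" by simp
      then show False using that by blast
    qed
    then show ?thesis by (auto simp: tree_gf_nth_odd)
  qed
  ultimately have "(\<lambda>n. tree_gf $ (2 * (n + 1)) * z ^ (2 * (n + 1))) sums
      (1 - exp (- (scaled_erf_inv z)\<^sup>2))"
    using sums_mono_reindex[of "\<lambda>n. 2 * (n + 1)" "\<lambda>m. tree_gf $ m * z ^ m"] by blast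
  then show ?thesis using tree_gf_nth_even[of "n + 1" for n] by (simp only: le_add2 times_divide_eq_left)
qed

theorem theorem3p1:
  shows
    "tree_gf =
       1 - (fps_exp 1 oo (- ((erf_inv_fps oo (fps_const (sqrt 2 / sqrt pi) * fps_X))\<^sup>2))) \<and>
     tree_gf =
       fps_const (sqrt pi) *
         (fps_integral0 erf_inv_fps oo (fps_const (sqrt 2 / sqrt pi) * fps_X)) \<and>
     (\<forall>z::real. \<bar>z\<bar> < sqrt (pi / 2) \<longrightarrow>
       (\<lambda>n. real (num_trees (n + 1)) * z ^ (2 * (n + 1)) / fact (2 * (n + 1))) sums
         (1 - exp (- ((erf_inv (sqrt 2 / sqrt pi * z))\<^sup>2))) \<and>
       1 - exp (- ((erf_inv (sqrt 2 / sqrt pi * z))\<^sup>2)) =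
         sqrt pi * (LBINT x=0..ereal (z * sqrt 2 / sqrt pi). erf_inv x)) \<and>
     (\<forall>n\<ge>1. real (num_trees n) = fact (2 * n - 2) / 2 ^ (n - 1) * erf_inv_coeff (n - 1)) \<and>
     (\<forall>n\<ge>2. num_trees n =
         (\<Sum>k=1..n - 1. ((2 * n - 2) choose (2 * k)) * num_trees k * num_trees (n - k))) \<and>
     num_trees 1 = 1"
proof (intro conjI allI impI)
  show "tree_gf =
      1 - (fps_exp 1 oo (- ((erf_inv_fps oo (fps_const (sqrt 2 / sqrt pi) * fps_X))\<^sup>2)))"
    using tree_gf_eq_exp unfolding scaled_erf_inv_fps_def .
  show "tree_gf = fps_const (sqrt pi) *
      (fps_integral0 erf_inv_fps oo (fps_const (sqrt 2 / sqrt pi) * fps_X))"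
    by (rule tree_gf_eq_integral)
  show "num_trees 1 = 1" by (rule num_trees_1)
next
  fix z :: real assume z: "\<bar>z\<bar> < sqrt (pi / 2)"
  show "(\<lambda>n. real (num_trees (n + 1)) * z ^ (2 * (n + 1)) / fact (2 * (n + 1))) sums
      (1 - exp (- ((erf_inv (sqrt 2 / sqrt pi * z))\<^sup>2)))"
    using tree_series_sums[OF z] unfolding scaled_erf_inv_def .
  have "z * sqrt 2 / sqrt pi = sqrt 2 / sqrt pi * z" by simp
  then show "1 - exp (- ((erf_inv (sqrt 2 / sqrt pi * z))\<^sup>2)) =
      sqrt pi * (LBINT x=0..ereal (z * sqrt 2 / sqrt pi). erf_inv x)"
    using exp_erf_inv_eq_integral[OF scaling_less_1[OF z]] by (simp only:)
next
  fix n :: nat assume "n \<ge> 1"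
  then show "real (num_trees n) = fact (2 * n - 2) / 2 ^ (n - 1) * erf_inv_coeff (n - 1)"
    using num_trees_eq_erf_inv_coeff[of "n - 1"] by (simp add: diff_mult_distrib2)
next
  fix n :: nat assume "n \<ge> 2"
  then show "num_trees n =
      (\<Sum>k=1..n - 1. ((2 * n - 2) choose (2 * k)) * num_trees k * num_trees (n - k))"
    by (rule num_trees_recurrence)
qed

end
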